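(* Assume the policy is proper. Then for every $x\in X$ $$J(x)=r(x)+\sum_{y\in X}P(y|x)J(y),$$ $$M(x)=r(x)^2+2r(x)\sum_{y\in X}P(y|x)J(y)+\sum_{y\in X}P(y|x)M(y).$$ Furthermore, this system of equations, regarded as a system for the unknown functions $J,M:X\to\mathbb{R}$, has a unique solution.
   Context: $X=\{1,\dots,n\}$ is a finite state set and $x^*\notin X$ is an absorbing terminal state. A fixed policy induces a time-homogeneous Markov chain $(x_k)_{k\ge0}$ on $X\cup\{x^*\}$ with transition probabilities $P(y|x)$, $x\in X$, $y\in X\cup\{x^*\}$. The reward is a deterministic function $r:X\to\mathbb{R}$. The policy is proper if, from every initial state, there is positive probability that $x^*$ is reached after at most $n$ transitions. Let $\tau=\min\{k>0:x_k=x^*\}$ and let $B=\sum_{k=0}^{\tau-1}r(x_k)$ be the accumulated reward. For $x\in X$ define the value function $J(x)=\mathbb{E}[B\mid x_0=x]$ and the second moment of the reward to go $M(x)=\mathbb{E}[B^2\mid x_0=x]$. *)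

theory Defs
  imports "HOL-Probability.Probability"
begin

text \<open>
  The states are the elements of a finite set \<open>X\<close> together with a terminal state \<open>xs\<close> outside \<open>X\<close>;
  \<open>P x y\<close> stands for the transition probability written \<open>P(y|x)\<close>, and only its values for
  \<open>x \<in> X\<close> and \<open>y \<in> insert xs X\<close> are used.
\<close>

definition transition_probabilities :: "'s set \<Rightarrow> 's \<Rightarrow> ('s \<Rightarrow> 's \<Rightarrow> real) \<Rightarrow> bool" where
  "transition_probabilities X xs P \<longleftrightarrow>
     (\<forall>x\<in>X. (\<forall>y\<in>insert xs X. 0 \<le> P x y) \<and> (\<Sum>y\<in>insert xs X. P x y) = 1)"

definition absorbing_extension :: "'s \<Rightarrow> ('s \<Rightarrow> 's \<Rightarrow> real) \<Rightarrow> 's \<Rightarrow> 's \<Rightarrow> real" where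
  "absorbing_extension xs P x y = (if x = xs then (if y = xs then 1 else 0) else P x y)"

text \<open>
  \<open>\<Omega>\<close> is any probability space carrying a process \<open>Z\<close> that is a time-homogeneous Markov chain with
  state space \<open>S\<close>, transition function \<open>Q\<close> and initial state \<open>x\<close>.
\<close>

definition markov_chain_from ::
  "'s set \<Rightarrow> ('s \<Rightarrow> 's \<Rightarrow> real) \<Rightarrow> 's \<Rightarrow> 'w measure \<Rightarrow> (nat \<Rightarrow> 'w \<Rightarrow> 's) \<Rightarrow> bool" where
  "markov_chain_from S Q x \<Omega> Z \<longleftrightarrow>
     prob_space \<Omega> \<and>
     (\<forall>k. Z k \<in> measurable \<Omega> (count_space S)) \<and>
     (AE \<omega> in \<Omega>. Z 0 \<omega> = x) \<and>
     (\<forall>k s. \<forall>y\<in>S. \<P>(\<omega> in \<Omega>. \<forall>i\<le>k. Z i \<omega> = s i) > 0 \<longrightarrow>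
        \<P>(\<omega> in \<Omega>. Z (Suc k) \<omega> = y \<bar> \<forall>i\<le>k. Z i \<omega> = s i) = Q (s k) y)"

text \<open>
  In the following, \<open>\<Omega> x\<close> is the probability space of the chain started in \<open>x\<close>, so that conditioning
  on \<open>x\<^sub>0 = x\<close> means taking probabilities and expectations with respect to \<open>\<Omega> x\<close>.
\<close>

definition proper :: "'s set \<Rightarrow> 's \<Rightarrow> ('s \<Rightarrow> 'w measure) \<Rightarrow> (nat \<Rightarrow> 'w \<Rightarrow> 's) \<Rightarrow> bool" where
  "proper X xs \<Omega> Z \<longleftrightarrow>
     (\<forall>x\<in>X. \<P>(\<omega> in \<Omega> x. \<exists>k\<le>card X. Z k \<omega> = xs) > 0)"

definition hitting_time :: "'s \<Rightarrow> (nat \<Rightarrow> 'w \<Rightarrow> 's) \<Rightarrow> 'w \<Rightarrow> enat" where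
  "hitting_time xs Z \<omega> = Inf {enat k | k. 0 < k \<and> Z k \<omega> = xs}"

text \<open>
  Where \<open>xs\<close> is never reached, the index set below is infinite and \<open>accumulated_reward\<close> is \<open>0\<close>.
\<close>

definition accumulated_reward ::
  "'s \<Rightarrow> ('s \<Rightarrow> real) \<Rightarrow> (nat \<Rightarrow> 'w \<Rightarrow> 's) \<Rightarrow> 'w \<Rightarrow> real" where
  "accumulated_reward xs r Z \<omega> = (\<Sum>k | enat k < hitting_time xs Z \<omega>. r (Z k \<omega>))"

definition value_function ::
  "'s \<Rightarrow> ('s \<Rightarrow> real) \<Rightarrow> ('s \<Rightarrow> 'w measure) \<Rightarrow> (nat \<Rightarrow> 'w \<Rightarrow> 's) \<Rightarrow> 's \<Rightarrow> real" where
  "value_function xs r \<Omega> Z x = (\<integral>\<omega>. accumulated_reward xs r Z \<omega> \<partial>\<Omega> x)"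

definition second_moment ::
  "'s \<Rightarrow> ('s \<Rightarrow> real) \<Rightarrow> ('s \<Rightarrow> 'w measure) \<Rightarrow> (nat \<Rightarrow> 'w \<Rightarrow> 's) \<Rightarrow> 's \<Rightarrow> real" where
  "second_moment xs r \<Omega> Z x = (\<integral>\<omega>. (accumulated_reward xs r Z \<omega>)\<^sup>2 \<partial>\<Omega> x)"

definition moment_equations ::
  "'s set \<Rightarrow> ('s \<Rightarrow> 's \<Rightarrow> real) \<Rightarrow> ('s \<Rightarrow> real) \<Rightarrow> ('s \<Rightarrow> real) \<Rightarrow> ('s \<Rightarrow> real) \<Rightarrow> bool" where
  "moment_equations X P r J M \<longleftrightarrow>
     (\<forall>x\<in>X. J x = r x + (\<Sum>y\<in>X. P x y * J y)) \<and>
     (\<forall>x\<in>X. M x = (r x)\<^sup>2 + 2 * r x * (\<Sum>y\<in>X. P x y * J y) + (\<Sum>y\<in>X. P x y * M y))"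

end

theory Submission
  imports Defs
begin

text \<open>
  Let \<open>A N = (\<Sum>k<N. r (Z k))\<close>, with \<open>r\<close> extended by \<open>0\<close> to the terminal state. Properness makes the
  killed transition operator on \<open>X\<close> a contraction after finitely many steps, so a Neumann series
  solves the linear system uniquely. For its solution \<open>(J, M)\<close>, extended by \<open>0\<close>, the processes
  \<open>A N + J (Z N)\<close> and \<open>(A N)\<^sup>2 + 2 * A N * J (Z N) + M (Z N)\<close> have constant expectation; their
  initial values are \<open>J x\<close> and \<open>M x\<close>, and they converge to \<open>B\<close> and \<open>B\<^sup>2\<close>. The survival
  probabilities decay geometrically, so the squared hitting time is integrable and dominates both.
\<close>

section \<open>Transient substochastic operators\<close>

text \<open>The transition operator of the chain killed on leaving \<open>X\<close>. The value 0 off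
  \<open>X\<close> makes its powers well behaved as operators on all functions.\<close>

definition step :: "'s set \<Rightarrow> ('s \<Rightarrow> 's \<Rightarrow> real) \<Rightarrow> ('s \<Rightarrow> real) \<Rightarrow> 's \<Rightarrow> real" where
  "step X P f x = (if x \<in> X then \<Sum>y\<in>X. P x y * f y else 0)"

locale substochastic =
  fixes X :: "'s set" and P :: "'s \<Rightarrow> 's \<Rightarrow> real"
  assumes finite_X: "finite X"
    and P_nonneg: "\<lbrakk>x \<in> X; y \<in> X\<rbrakk> \<Longrightarrow> 0 \<le> P x y"
    and P_sum_le: "x \<in> X \<Longrightarrow> (\<Sum>y\<in>X. P x y) \<le> 1"
begin

text \<open>The probability that the chain started in \<open>x\<close> is still in \<open>X\<close>
  after \<open>k\<close> transitions, as \<open>prob_survival\<close> confirms. The operator form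
  needs no probability space.\<close>

definition survival :: "nat \<Rightarrow> 's \<Rightarrow> real" where
  "survival k = (step X P ^^ k) (indicator X)"

lemma step_mono:
  assumes "\<And>y. y \<in> X \<Longrightarrow> f y \<le> g y"
  shows "step X P f x \<le> step X P g x"
  using assms P_nonneg by (auto simp: step_def intro!: sum_mono mult_left_mono)

lemma survival_0: "survival 0 = indicator X"
  by (simp add: survival_def)

lemma survival_Suc: "survival (Suc k) = step X P (survival k)"
  by (simp add: survival_def)

lemma survival_nonneg: "0 \<le> survival k x"
proof (induction k arbitrary: x)
  case (Suc k)
  then show ?case
    using P_nonneg by (auto simp: survival_Suc step_def intro!: sum_nonneg)
qed (simp add: survival_0)

text \<open>Positivity of the operator preserves domination by \<open>C\<close> times the indicator
  of \<open>X\<close>. Every convergence estimate for iterates rests on this comparison with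
  \<open>survival\<close>.\<close>

lemma abs_step_iter_le:
  assumes "\<And>y. y \<in> X \<Longrightarrow> \<bar>g y\<bar> \<le> C" and "x \<in> X"
  shows "\<bar>(step X P ^^ k) g x\<bar> \<le> C * survival k x"
  using assms(2)
proof (induction k arbitrary: x)
  case 0
  then show ?case using assms(1) by (simp add: survival_0)
next
  case (Suc k)
  have "\<bar>(step X P ^^ Suc k) g x\<bar> \<le> (\<Sum>y\<in>X. \<bar>P x y * (step X P ^^ k) g y\<bar>)"
    using Suc.prems by (simp add: step_def)
  also have "\<dots> \<le> (\<Sum>y\<in>X. P x y * (C * survival k y))"
    using Suc P_nonneg by (intro sum_mono) (auto simp: abs_mult intro!: mult_left_mono)
  also have "\<dots> = C * survival (Suc k) x"
    using Suc.prems by (simp add: survival_Suc step_def sum_distrib_left mult_ac)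
  finally show ?case .
qed

text \<open>Row sums at most 1 give the case of the indicator; monotonicity of \<open>step\<close>
  carries the inequality to all later times.\<close>

lemma survival_Suc_le: "survival (Suc k) x \<le> survival k x"
proof (induction k arbitrary: x)
  case 0
  have "(\<Sum>y\<in>X. P x y * indicator X y) = (\<Sum>y\<in>X. P x y)"
    by (rule sum.cong) auto
  then show ?case
    using P_sum_le by (simp add: survival_0 survival_Suc step_def)
next
  case (Suc k)
  then show ?case
    by (metis step_mono survival_Suc)
qed

lemma survival_antimono: "i \<le> j \<Longrightarrow> survival j x \<le> survival i x"
  by (rule lift_Suc_antimono_le[of "\<lambda>k. survival k x"]) (auto intro: survival_Suc_le)

end

section \<open>Geometric decay of the survival probabilities\<close>

locale transient = substochastic +
  fixes m :: nat
  assumes m_pos: "0 < m" and survival_less_1: "x \<in> X \<Longrightarrow> survival m x < 1"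
begin

text \<open>Since \<open>X\<close> is finite, the bounds at time \<open>m\<close> are uniform: each
  block of \<open>m\<close> steps loses a fixed factor \<rho> < 1. The \<open>m\<close>-th root of
  \<rho> is the rate per step.\<close>

lemma survival_geometric:
  obtains K \<sigma> where "0 < \<sigma>" "\<sigma> < 1" "\<And>k x. x \<in> X \<Longrightarrow> survival k x \<le> K * \<sigma> ^ k"
proof -
  \<comment> \<open>Including \<open>1/2\<close> keeps \<rho> positive even if all survival
    probabilities at time \<open>m\<close> vanish, so that it can serve as a divisor.\<close>
  define \<rho> where "\<rho> = Max (insert (1/2) (survival m ` X))"
  have \<rho>: "0 < \<rho>" "\<rho> < 1"
    using finite_X survival_less_1 unfolding \<rho>_def
    by (auto simp: Max_gr_iff Max_less_iff)
  have survival_m: "survival m x \<le> \<rho>" if "x \<in> X" for x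
    unfolding \<rho>_def using that finite_X by (intro Max_ge) auto
  have survival_mult: "survival (q * m) x \<le> \<rho> ^ q" if "x \<in> X" for q x
    using that
  proof (induction q)
    case 0
    then show ?case by (simp add: survival_0)
  next
    case (Suc q)
    \<comment> \<open>The last block turns the indicator into \<open>survival m\<close>, which is at
      most \<rho> on \<open>X\<close>; the other \<open>q\<close> blocks then act on a function
      bounded by \<rho>.\<close>
    have "survival (q * m + m) x = (step X P ^^ (q * m)) (survival m) x"
      by (simp only: survival_def funpow_add comp_apply)
    then have "survival (Suc q * m) x = (step X P ^^ (q * m)) (survival m) x"
      by (simp add: add.commute)
    also have "\<dots> \<le> \<rho> * survival (q * m) x"
      using abs_step_iter_le[of "survival m" \<rho> x "q * m"] survival_m survival_nonneg Suc.prems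
      by fastforce
    also have "\<dots> \<le> \<rho> ^ Suc q"
      using Suc \<rho> by (simp add: mult_left_mono)
    finally show ?case .
  qed
  define \<sigma> where "\<sigma> = root m \<rho>"
  have \<sigma>: "0 < \<sigma>" "\<sigma> < 1" "\<sigma> ^ m = \<rho>"
    using \<rho> m_pos by (simp_all add: \<sigma>_def)
  \<comment> \<open>The constant \<open>1 / \<rho>\<close>, which is \<sigma> to the power
    \<open>-m\<close>, pays for the incomplete last block of \<open>k mod m\<close> steps.\<close>
  have "survival k x \<le> (1 / \<rho>) * \<sigma> ^ k" if "x \<in> X" for k x
  proof -
    have "survival k x \<le> survival ((k div m) * m) x"
      by (rule survival_antimono) simp
    also have "\<dots> \<le> \<sigma> ^ (m * (k div m))"
      using survival_mult[OF that, of "k div m"] \<sigma>(3) by (simp add: power_mult)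
    also have "\<dots> \<le> \<sigma> ^ (m * (k div m)) * (\<sigma> ^ (k mod m) / \<sigma> ^ m)"
    proof -
      have "\<sigma> ^ m \<le> \<sigma> ^ (k mod m)"
        using \<sigma> m_pos by (intro power_decreasing) auto
      then have "1 \<le> \<sigma> ^ (k mod m) / \<sigma> ^ m"
        using \<sigma>(1) by (simp add: le_divide_eq_1)
      then have "\<sigma> ^ (m * (k div m)) * 1 \<le> \<sigma> ^ (m * (k div m)) * (\<sigma> ^ (k mod m) / \<sigma> ^ m)"
        using \<sigma>(1) by (intro mult_left_mono) auto
      then show ?thesis by simp
    qed
    also have "\<dots> = (1 / \<rho>) * \<sigma> ^ k"
      using \<sigma>(3) by (simp add: power_add[symmetric])
    finally show ?thesis .
  qed
  with \<sigma> show ?thesis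
    using that by blast
qed

text \<open>Geometric decay beats the linear weight, by comparison with the differentiated geometric
  series. The weights are the successive odd numbers, so that the sum will be the expected square of
  the hitting time.\<close>

lemma summable_survival:
  assumes "x \<in> X"
  shows "summable (\<lambda>k. (2 * real k + 1) * survival k x)"
proof -
  obtain K \<sigma> where *: "0 < \<sigma>" "\<sigma> < 1" "\<And>k x. x \<in> X \<Longrightarrow> survival k x \<le> K * \<sigma> ^ k"
    by (rule survival_geometric) (rule that)
  have "summable (\<lambda>k. (2 * K) * (of_nat (Suc k) * \<sigma> ^ k))"
    using geometric_deriv_sums[of \<sigma>] * by (intro summable_mult) (auto simp: sums_iff)
  then show ?thesis
  proof (rule summable_comparison_test'[where N = 0])
    fix k :: nat
    have "0 \<le> survival k x" by (rule survival_nonneg)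
    then have "norm ((2 * real k + 1) * survival k x) \<le> (2 * real (Suc k)) * survival k x"
      by (simp add: abs_mult mult_right_mono)
    also have "\<dots> \<le> (2 * real (Suc k)) * (K * \<sigma> ^ k)"
      using * assms by (intro mult_left_mono) auto
    finally show "norm ((2 * real k + 1) * survival k x) \<le> 2 * K * (real (Suc k) * \<sigma> ^ k)"
      by (simp add: mult_ac)
  qed
qed

lemma summable_survival': "x \<in> X \<Longrightarrow> summable (\<lambda>k. survival k x)"
proof (rule summable_comparison_test'[OF summable_survival, where N = 0])
  fix k
  have "1 * survival k x \<le> (2 * real k + 1) * survival k x"
    by (intro mult_right_mono survival_nonneg) simp
  then show "norm (survival k x) \<le> (2 * real k + 1) * survival k x"
    by (simp add: survival_nonneg)
qed

lemma survival_tendsto_0: "x \<in> X \<Longrightarrow> (\<lambda>k. survival k x) \<longlonglongrightarrow> 0"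
  by (intro summable_LIMSEQ_zero summable_survival')

section \<open>Existence and uniqueness for Poisson equations on \<open>X\<close>\<close>

lemma bounded_on_X: obtains C where "\<And>y. y \<in> X \<Longrightarrow> \<bar>g y :: real\<bar> \<le> C"
  using finite_X that[of "Max ((\<lambda>y. \<bar>g y\<bar>) ` X)"] by auto

text \<open>Applying the operator to the Neumann series of \<open>b\<close> shifts it by one term,
  leaving exactly \<open>b\<close> as the difference. The series converges absolutely by comparison
  with the summable survival probabilities.\<close>

lemma poisson_exists: "\<exists>f. \<forall>x\<in>X. f x = b x + (\<Sum>y\<in>X. P x y * f y)"
proof (intro exI ballI)
  \<comment> \<open>The witness stays schematic until the final \<open>show\<close>, where it
    becomes the Neumann series; that series does not depend on this \<open>x\<close>.\<close>
  fix x assume x: "x \<in> X"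
  let ?t = "\<lambda>k. (step X P ^^ k) b"
  obtain C where C: "\<And>y. y \<in> X \<Longrightarrow> \<bar>b y\<bar> \<le> C"
    by (rule bounded_on_X) (rule that)
  have summable: "summable (\<lambda>k. ?t k y)" if "y \<in> X" for y
    by (rule summable_comparison_test'[OF summable_mult[OF summable_survival'[OF that], of C],
          where N = 0])
      (use abs_step_iter_le[of b C] C that in auto)
  have "(\<Sum>k. ?t k x) = b x + (\<Sum>k. ?t (Suc k) x)"
    using suminf_split_head[OF summable[OF x]] by simp
  also have "(\<Sum>k. ?t (Suc k) x) = (\<Sum>k. \<Sum>y\<in>X. P x y * ?t k y)"
    using x by (simp add: step_def)
  also have "\<dots> = (\<Sum>y\<in>X. \<Sum>k. P x y * ?t k y)"
    using summable by (intro suminf_sum summable_mult)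
  also have "\<dots> = (\<Sum>y\<in>X. P x y * (\<Sum>k. ?t k y))"
    using summable by (intro sum.cong suminf_mult refl)
  finally show "(\<lambda>y. \<Sum>k. ?t k y) x = b x + (\<Sum>y\<in>X. P x y * (\<lambda>y. \<Sum>k. ?t k y) y)" .
qed

text \<open>A harmonic function is fixed by every iterate of the operator, hence bounded by a
  constant times \<open>survival k\<close>, which tends to 0.\<close>

lemma harmonic_eq_0:
  assumes "\<And>y. y \<in> X \<Longrightarrow> d y = (\<Sum>z\<in>X. P y z * d z)" and "x \<in> X"
  shows "d x = 0"
proof -
  obtain C where C: "\<And>y. y \<in> X \<Longrightarrow> \<bar>d y\<bar> \<le> C"
    by (rule bounded_on_X) (rule that)
  have iter: "(step X P ^^ k) d y = d y" if "y \<in> X" for k y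
    using that
  proof (induction k arbitrary: y)
    case (Suc k)
    have "(step X P ^^ Suc k) d y = step X P ((step X P ^^ k) d) y"
      by simp
    also have "\<dots> = (\<Sum>z\<in>X. P y z * d z)"
      using Suc.prems by (simp add: step_def Suc.IH cong: sum.cong)
    finally have "(step X P ^^ Suc k) d y = (\<Sum>z\<in>X. P y z * d z)" .
    with Suc.prems assms(1) show ?case by metis
  qed simp
  have "\<bar>d x\<bar> \<le> C * survival k x" for k
    using abs_step_iter_le[of d C x k] C assms(2) iter by auto
  moreover have "(\<lambda>k. C * survival k x) \<longlonglongrightarrow> C * 0"
    by (intro tendsto_mult_left survival_tendsto_0 assms)
  ultimately have "\<bar>d x\<bar> \<le> C * 0"
    using LIMSEQ_le_const by blast
  then show ?thesis by simp
qed

lemma poisson_unique: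
  assumes f: "\<And>y. y \<in> X \<Longrightarrow> f y = b y + (\<Sum>z\<in>X. P y z * f z)"
    and g: "\<And>y. y \<in> X \<Longrightarrow> g y = b y + (\<Sum>z\<in>X. P y z * g z)"
    and "x \<in> X"
  shows "f x = g x"
proof -
  have "f y - g y = (\<Sum>z\<in>X. P y z * (f z - g z))" if "y \<in> X" for y
    using f[OF that] g[OF that] by (simp add: right_diff_distrib sum_subtractf)
  from harmonic_eq_0[of "\<lambda>y. f y - g y", OF this \<open>x \<in> X\<close>] show ?thesis by simp
qed

section \<open>The triangular system for both moments\<close>

lemma moment_equations_exists: "\<exists>J M. moment_equations X P r J M"
proof -
  obtain J where "\<forall>x\<in>X. J x = r x + (\<Sum>y\<in>X. P x y * J y)"
    using poisson_exists by blast
  \<comment> \<open>Once \<open>J\<close> is known, the second equation is a Poisson equation for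
    the same operator with a different inhomogeneity.\<close>
  moreover obtain M where "\<forall>x\<in>X. M x =
      ((r x)\<^sup>2 + 2 * r x * (\<Sum>y\<in>X. P x y * J y)) + (\<Sum>y\<in>X. P x y * M y)"
    using poisson_exists[of "\<lambda>x. (r x)\<^sup>2 + 2 * r x * (\<Sum>y\<in>X. P x y * J y)"] by blast
  ultimately have "moment_equations X P r J M"
    unfolding moment_equations_def by (rule conjI)
  then show ?thesis by blast
qed

lemma moment_equations_unique:
  assumes "moment_equations X P r J M" and "moment_equations X P r J' M'" and "x \<in> X"
  shows "J x = J' x" and "M x = M' x"
proof -
  let ?b = "\<lambda>J x. (r x)\<^sup>2 + 2 * r x * (\<Sum>y\<in>X. P x y * J y)"
  note eqs = assms(1,2)[unfolded moment_equations_def]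
  have J: "J y = J' y" if "y \<in> X" for y
    by (rule poisson_unique[OF eqs(1)[THEN conjunct1, rule_format]
          eqs(2)[THEN conjunct1, rule_format] that])
  then show "J x = J' x" using \<open>x \<in> X\<close> .
  \<comment> \<open>Agreement of the first components on \<open>X\<close> makes the inhomogeneities
    of the two second equations equal, so \<open>poisson_unique\<close> applies again.\<close>
  have "(\<Sum>z\<in>X. P y z * J' z) = (\<Sum>z\<in>X. P y z * J z)" for y
    using J by (intro sum.cong) auto
  then have "M' y = ?b J y + (\<Sum>z\<in>X. P y z * M' z)" if "y \<in> X" for y
    using eqs(2)[THEN conjunct2, rule_format, OF that] by (simp only:)
  with eqs(1)[THEN conjunct2, rule_format] show "M x = M' x"
    using \<open>x \<in> X\<close> by (rule poisson_unique[where b = "?b J"])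
qed

end

lemma moment_equations_cong:
  assumes "\<And>x. x \<in> X \<Longrightarrow> J x = J' x" "\<And>x. x \<in> X \<Longrightarrow> M x = M' x"
  shows "moment_equations X P r J M \<longleftrightarrow> moment_equations X P r J' M'"
  using assms by (simp add: moment_equations_def)

text \<open>The equations constrain values on \<open>X\<close> only, so uniqueness is stated for
  \<open>\<rightarrow>\<^sub>E\<close>, which fixes the value \<open>undefined\<close> elsewhere and
  thus encodes functions with domain \<open>X\<close>.\<close>

lemma (in transient) ex1_moment_equations:
  "\<exists>!(J, M). J \<in> X \<rightarrow>\<^sub>E UNIV \<and> M \<in> X \<rightarrow>\<^sub>E UNIV \<and> moment_equations X P r J M"
proof -
  obtain J M where JM: "moment_equations X P r J M"
    using moment_equations_exists by blast
  show ?thesis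
  proof (rule ex1I[of _ "(restrict J X, restrict M X)"], goal_cases)
    case 1
    have "moment_equations X P r (restrict J X) (restrict M X)"
      using JM by (subst moment_equations_cong[of X _ J _ M]) auto
    then show ?case by simp
  next
    case (2 p)
    obtain J' M' where p: "p = (J', M')" by (cases p)
    with 2 have 3: "J' \<in> X \<rightarrow>\<^sub>E UNIV" "M' \<in> X \<rightarrow>\<^sub>E UNIV" "moment_equations X P r J' M'"
      by auto
    have "J' = restrict J X" "M' = restrict M X"
      using moment_equations_unique[OF 3(3) JM] 3(1,2)
      by (auto intro!: extensionalityI[of _ X] simp: PiE_def)
    with p show ?case by simp
  qed
qed

section \<open>The absorbing chain\<close>

locale absorbing_chain = prob_space \<Omega> for \<Omega> :: "'w measure" +
  fixes X :: "'s set" and xs :: 's and P :: "'s \<Rightarrow> 's \<Rightarrow> real" and x :: 's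
    and Z :: "nat \<Rightarrow> 'w \<Rightarrow> 's"
  assumes finite_states: "finite X" and xs_notin: "xs \<notin> X" and x_in: "x \<in> X"
    and transition: "transition_probabilities X xs P"
    and chain: "markov_chain_from (insert xs X) (absorbing_extension xs P) x \<Omega> Z"
begin

abbreviation S :: "'s set" where "S \<equiv> insert xs X"
abbreviation Q :: "'s \<Rightarrow> 's \<Rightarrow> real" where "Q \<equiv> absorbing_extension xs P"

sublocale substochastic X P
proof
  fix y assume y: "y \<in> X"
  then have "P y xs + (\<Sum>z\<in>X. P y z) = 1" "0 \<le> P y xs"
    using transition finite_states xs_notin by (auto simp: transition_probabilities_def)
  then show "(\<Sum>z\<in>X. P y z) \<le> 1" by linarith
qed (use transition finite_states in \<open>auto simp: transition_probabilities_def\<close>)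

lemma Q_sum: "z \<in> S \<Longrightarrow> (\<Sum>y\<in>S. Q z y) = 1"
  using transition finite_X xs_notin
  by (auto simp: transition_probabilities_def absorbing_extension_def)

text \<open>A function vanishing at \<open>xs\<close> cannot see the terminal column, so the full
  and the killed operator agree on it; at \<open>z = xs\<close> both give 0.\<close>

lemma Q_sum_step:
  assumes "g xs = 0" "z \<in> S"
  shows "(\<Sum>y\<in>S. Q z y * g y) = step X P g z"
proof -
  have "(\<Sum>y\<in>X. Q xs y * g y) = 0"
    using xs_notin by (intro sum.neutral) (auto simp: absorbing_extension_def)
  moreover have "(\<Sum>y\<in>X. Q z y * g y) = (\<Sum>y\<in>X. P z y * g y)" if "z \<noteq> xs"
    using that by (simp add: absorbing_extension_def)
  ultimately show ?thesis
    using assms finite_X xs_notin by (auto simp: step_def)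
qed

section \<open>Measurability and the Markov property in expectation\<close>

lemma measurable_Z: "Z k \<in> measurable \<Omega> (count_space S)"
  using chain by (simp add: markov_chain_from_def)

lemma measurable_Z_UNIV [measurable]: "Z k \<in> measurable \<Omega> (count_space UNIV)"
  using measurable_compose[OF measurable_Z, of "\<lambda>y. y"] by simp

lemma Z_in: "\<omega> \<in> space \<Omega> \<Longrightarrow> Z k \<omega> \<in> S"
  using measurable_space[OF measurable_Z] by simp

lemma Z_in_X_iff: "\<omega> \<in> space \<Omega> \<Longrightarrow> Z k \<omega> \<in> X \<longleftrightarrow> Z k \<omega> \<noteq> xs"
  using Z_in xs_notin by fastforce

lemma pred_Z_in [measurable]: "Measurable.pred \<Omega> (\<lambda>\<omega>. Z k \<omega> \<in> A)"
  by (rule measurable_compose[OF measurable_Z_UNIV]) simp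

lemma borel_measurable_Z: "(\<lambda>\<omega>. f (Z k \<omega>) :: real) \<in> borel_measurable \<Omega>"
  by (rule measurable_compose[OF measurable_Z_UNIV]) simp

lemma AE_start: "AE \<omega> in \<Omega>. Z 0 \<omega> = x"
  using chain by (simp add: markov_chain_from_def)

text \<open>The product form of the Markov property also covers null histories, where the
  conditional probability carries no information but both sides are 0.\<close>

lemma prob_history_Suc:
  assumes "y \<in> S"
  shows "\<P>(\<omega> in \<Omega>. (\<forall>i\<le>k. Z i \<omega> = h i) \<and> Z (Suc k) \<omega> = y) =
    \<P>(\<omega> in \<Omega>. \<forall>i\<le>k. Z i \<omega> = h i) * Q (h k) y"
proof (cases "\<P>(\<omega> in \<Omega>. \<forall>i\<le>k. Z i \<omega> = h i) > 0")
  case True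
  then have "\<P>(\<omega> in \<Omega>. Z (Suc k) \<omega> = y \<bar> \<forall>i\<le>k. Z i \<omega> = h i) = Q (h k) y"
    using chain[unfolded markov_chain_from_def] assms by blast
  with True show ?thesis
    by (simp add: cond_prob_def field_simps conj_commute)
next
  case False
  then have zero: "\<P>(\<omega> in \<Omega>. \<forall>i\<le>k. Z i \<omega> = h i) = 0"
    using zero_less_measure_iff by blast
  have "\<P>(\<omega> in \<Omega>. (\<forall>i\<le>k. Z i \<omega> = h i) \<and> Z (Suc k) \<omega> = y) \<le>
      \<P>(\<omega> in \<Omega>. \<forall>i\<le>k. Z i \<omega> = h i)"
    by (rule finite_measure_mono) auto
  with zero show ?thesis
    by (simp add: measure_le_0_iff)
qed

text \<open>
  Functions of the history are given on all paths, so they must be assumed to depend only on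
  the first \<open>k + 1\<close> positions.
\<close>

lemma expectation_step:
  fixes \<Phi> :: "(nat \<Rightarrow> 's) \<Rightarrow> 's \<Rightarrow> real"
  assumes local: "\<And>h h' y. (\<And>i. i \<le> k \<Longrightarrow> h i = h' i) \<Longrightarrow> \<Phi> h y = \<Phi> h' y"
  shows "expectation (\<lambda>\<omega>. \<Phi> (\<lambda>i. Z i \<omega>) (Z (Suc k) \<omega>)) =
    expectation (\<lambda>\<omega>. \<Sum>y\<in>S. Q (Z k \<omega>) y * \<Phi> (\<lambda>i. Z i \<omega>) y)"
proof -
  \<comment> \<open>Only finitely many histories up to time \<open>k\<close> exist, so expectations
    become finite sums over the events \<open>E h\<close> and \<open>E' h y\<close>, to which the
    product form applies.\<close>
  define H where "H = {..k} \<rightarrow>\<^sub>E S"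
  have finite: "finite H" "finite S"
    using finite_X by (auto simp: H_def intro!: finite_PiE)
  define E where "E h = {\<omega> \<in> space \<Omega>. \<forall>i\<le>k. Z i \<omega> = h i}" for h
  define E' where "E' h y = {\<omega> \<in> space \<Omega>. (\<forall>i\<le>k. Z i \<omega> = h i) \<and> Z (Suc k) \<omega> = y}" for h y
  have [measurable]: "E h \<in> events" "E' h y \<in> events" for h y
    unfolding E_def E'_def by measurable
  have prob_E': "prob (E' h y) = prob (E h) * Q (h k) y" if "y \<in> S" for h y
    unfolding E_def E'_def by (rule prob_history_Suc[OF that])
  \<comment> \<open>The events \<open>E h\<close> partition the space: the only matching history in
    \<open>H\<close> is the path restricted to \<open>{..k}\<close>, and by locality
    \<open>F\<close> takes the same value there.\<close>
  have decompose: "F (\<lambda>i. Z i \<omega>) = (\<Sum>h\<in>H. F h * indicator (E h) \<omega>)"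
    if "\<omega> \<in> space \<Omega>" and F: "\<And>h h'. (\<And>i. i \<le> k \<Longrightarrow> h i = h' i) \<Longrightarrow> F h = F h'"
    for F :: "(nat \<Rightarrow> 's) \<Rightarrow> real" and \<omega>
  proof -
    let ?h = "restrict (\<lambda>i. Z i \<omega>) {..k}"
    have "?h \<in> H"
      using Z_in[OF \<open>\<omega> \<in> space \<Omega>\<close>] by (auto simp: H_def)
    have "indicator (E h) \<omega> = (if h = ?h then 1 else 0 :: real)" if "h \<in> H" for h
      using that \<open>\<omega> \<in> space \<Omega>\<close>
      by (auto simp: E_def H_def indicator_def PiE_def extensional_def fun_eq_iff)
    then have "(\<Sum>h\<in>H. F h * indicator (E h) \<omega>) = (\<Sum>h\<in>H. if h = ?h then F h else 0)"
      by (intro sum.cong) auto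
    also have "\<dots> = F ?h"
      using \<open>?h \<in> H\<close> finite by simp
    also have "\<dots> = F (\<lambda>i. Z i \<omega>)"
      by (rule F) simp
    finally show ?thesis ..
  qed
  have "\<Phi> (\<lambda>i. Z i \<omega>) (Z (Suc k) \<omega>) = (\<Sum>h\<in>H. \<Sum>y\<in>S. \<Phi> h y * indicator (E' h y) \<omega>)"
    if \<omega>: "\<omega> \<in> space \<Omega>" for \<omega>
  proof -
    have "(\<Sum>y\<in>S. \<Phi> h y * indicator (E' h y) \<omega>) = \<Phi> h (Z (Suc k) \<omega>) * indicator (E h) \<omega>" for h
    proof -
      have "(\<Sum>y\<in>S. \<Phi> h y * indicator (E' h y) \<omega>) =
          (\<Sum>y\<in>S. if y = Z (Suc k) \<omega> then \<Phi> h y * indicator (E h) \<omega> else 0)"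
        using \<omega> by (intro sum.cong) (auto simp: E_def E'_def indicator_def)
      also have "\<dots> = \<Phi> h (Z (Suc k) \<omega>) * indicator (E h) \<omega>"
        using Z_in[OF \<omega>] finite(2) by (subst sum.delta) auto
      finally show ?thesis .
    qed
    moreover have "\<Phi> (\<lambda>i. Z i \<omega>) (Z (Suc k) \<omega>) =
        (\<Sum>h\<in>H. \<Phi> h (Z (Suc k) \<omega>) * indicator (E h) \<omega>)"
      by (rule decompose[OF \<omega>]) (rule local)
    ultimately show ?thesis by (simp only:)
  qed
  then have "expectation (\<lambda>\<omega>. \<Phi> (\<lambda>i. Z i \<omega>) (Z (Suc k) \<omega>)) =
      expectation (\<lambda>\<omega>. \<Sum>h\<in>H. \<Sum>y\<in>S. \<Phi> h y * indicator (E' h y) \<omega>)"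
    by (intro Bochner_Integration.integral_cong) auto
  also have "\<dots> = (\<Sum>h\<in>H. \<Sum>y\<in>S. \<Phi> h y * prob (E' h y))"
    by (subst Bochner_Integration.integral_sum; simp add: emeasure_eq_measure)+
  also have "\<dots> = (\<Sum>h\<in>H. (\<Sum>y\<in>S. Q (h k) y * \<Phi> h y) * prob (E h))"
    unfolding sum_distrib_right by (intro sum.cong refl) (simp add: prob_E' mult_ac)
  also have "\<dots> = expectation (\<lambda>\<omega>. \<Sum>h\<in>H. (\<Sum>y\<in>S. Q (h k) y * \<Phi> h y) * indicator (E h) \<omega>)"
    by (subst Bochner_Integration.integral_sum; simp add: emeasure_eq_measure)
  also have "\<dots> = expectation (\<lambda>\<omega>. \<Sum>y\<in>S. Q (Z k \<omega>) y * \<Phi> (\<lambda>i. Z i \<omega>) y)"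
  proof (rule Bochner_Integration.integral_cong[OF refl])
    fix \<omega> assume "\<omega> \<in> space \<Omega>"
    then show "(\<Sum>h\<in>H. (\<Sum>y\<in>S. Q (h k) y * \<Phi> h y) * indicator (E h) \<omega>) =
        (\<Sum>y\<in>S. Q (Z k \<omega>) y * \<Phi> (\<lambda>i. Z i \<omega>) y)"
      by (intro decompose[symmetric] sum.cong arg_cong2[where f = "(*)"] local) auto
  qed
  finally show ?thesis .
qed

lemma expectation_start: "expectation (\<lambda>\<omega>. f (Z 0 \<omega>) :: real) = f x"
proof -
  have "expectation (\<lambda>\<omega>. f (Z 0 \<omega>)) = expectation (\<lambda>\<omega>. f x)"
    using AE_start by (intro integral_cong_AE borel_measurable_Z) auto
  then show ?thesis by (simp add: prob_space)
qed

text \<open>Averaging over the last transition replaces \<open>g\<close> by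
  \<open>step X P g\<close>, which again vanishes at \<open>xs\<close>; hence the induction runs
  with \<open>g\<close> arbitrary.\<close>

lemma expectation_iter:
  assumes "g xs = 0"
  shows "expectation (\<lambda>\<omega>. g (Z k \<omega>)) = (step X P ^^ k) g x"
  using assms
proof (induction k arbitrary: g)
  case 0
  then show ?case by (simp add: expectation_start)
next
  case (Suc k)
  have "expectation (\<lambda>\<omega>. g (Z (Suc k) \<omega>)) = expectation (\<lambda>\<omega>. \<Sum>y\<in>S. Q (Z k \<omega>) y * g y)"
    by (rule expectation_step[of k "\<lambda>h. g"]) simp
  also have "\<dots> = expectation (\<lambda>\<omega>. step X P g (Z k \<omega>))"
    using Suc.prems by (intro Bochner_Integration.integral_cong Q_sum_step Z_in) auto
  also have "\<dots> = (step X P ^^ k) (step X P g) x"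
    using xs_notin by (intro Suc.IH) (simp add: step_def)
  finally show ?case by (simp add: funpow_swap1)
qed

section \<open>Survival probabilities and absorption\<close>

lemma expectation_survival: "expectation (\<lambda>\<omega>. indicator X (Z k \<omega>)) = survival k x"
  unfolding survival_def using xs_notin by (intro expectation_iter) simp

lemma prob_survival: "\<P>(\<omega> in \<Omega>. Z k \<omega> \<in> X) = survival k x"
proof -
  have "survival k x = expectation (indicator {\<omega> \<in> space \<Omega>. Z k \<omega> \<in> X})"
    unfolding expectation_survival[symmetric]
    by (intro Bochner_Integration.integral_cong) (auto simp: indicator_def)
  moreover have "{\<omega> \<in> space \<Omega>. Z k \<omega> \<in> X} \<inter> space \<Omega> = {\<omega> \<in> space \<Omega>. Z k \<omega> \<in> X}"
    by blast
  ultimately show ?thesis by simp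
qed

lemma AE_absorbing: "AE \<omega> in \<Omega>. \<forall>k. Z k \<omega> = xs \<longrightarrow> Z (Suc k) \<omega> = xs"
  unfolding AE_all_countable
proof
  fix k
  \<comment> \<open>This is the indicator of leaving \<open>xs\<close> at step \<open>k\<close>. Its
    one-step average is 0 because \<open>Q xs y\<close> is 0 for \<open>y\<close> other than
    \<open>xs\<close>, and a nonnegative function with integral 0 vanishes almost
    everywhere.\<close>
  define \<Phi> :: "(nat \<Rightarrow> 's) \<Rightarrow> 's \<Rightarrow> real" where
    "\<Phi> h y = indicator {xs} (h k) * indicator (- {xs}) y" for h y
  have "expectation (\<lambda>\<omega>. \<Phi> (\<lambda>i. Z i \<omega>) (Z (Suc k) \<omega>)) =
      expectation (\<lambda>\<omega>. \<Sum>y\<in>S. Q (Z k \<omega>) y * \<Phi> (\<lambda>i. Z i \<omega>) y)"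
    by (rule expectation_step) (simp add: \<Phi>_def)
  also have "(\<lambda>\<omega>. \<Sum>y\<in>S. Q (Z k \<omega>) y * \<Phi> (\<lambda>i. Z i \<omega>) y) = (\<lambda>\<omega>. 0)"
    by (intro ext sum.neutral) (auto simp: \<Phi>_def absorbing_extension_def indicator_def)
  finally have "expectation (\<lambda>\<omega>. indicator {xs} (Z k \<omega>) * indicator (- {xs}) (Z (Suc k) \<omega>)) = (0::real)"
    by (simp add: \<Phi>_def)
  moreover have "integrable \<Omega> (\<lambda>\<omega>. indicator {xs} (Z k \<omega>) * indicator (- {xs}) (Z (Suc k) \<omega>) :: real)"
    by (rule integrable_const_bound[where B = 1]) (auto simp: indicator_def)
  ultimately have "AE \<omega> in \<Omega>. indicator {xs} (Z k \<omega>) * indicator (- {xs}) (Z (Suc k) \<omega>) = (0::real)"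
    by (subst (asm) integral_nonneg_eq_0_iff_AE) auto
  then show "AE \<omega> in \<Omega>. Z k \<omega> = xs \<longrightarrow> Z (Suc k) \<omega> = xs"
    by eventually_elim (auto simp: indicator_def split: if_splits)
qed

lemma absorbing_le:
  assumes "\<forall>k. Z k \<omega> = xs \<longrightarrow> Z (Suc k) \<omega> = xs" "Z i \<omega> = xs" "i \<le> j"
  shows "Z j \<omega> = xs"
  using assms(3,2) by (induction rule: dec_induct) (use assms(1) in auto)

text \<open>By absorption, a path that reaches \<open>xs\<close> by time \<open>m\<close> is almost
  surely there at time \<open>m\<close>. This turns properness into the strict inequality required
  by \<open>transient\<close>.\<close>

lemma survival_less_1_if_reaches:
  assumes "\<P>(\<omega> in \<Omega>. \<exists>k\<le>m. Z k \<omega> = xs) > 0"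
  shows "survival m x < 1"
proof -
  have "AE \<omega> in \<Omega>. \<omega> \<in> {\<omega> \<in> space \<Omega>. \<exists>k\<le>m. Z k \<omega> = xs} \<longrightarrow>
      \<omega> \<in> {\<omega> \<in> space \<Omega>. \<not> Z m \<omega> \<in> X}"
    using AE_absorbing
  proof eventually_elim
    case (elim \<omega>)
    then have "Z m \<omega> = xs" if "k \<le> m" "Z k \<omega> = xs" for k
      using absorbing_le that by blast
    then show ?case using xs_notin by auto
  qed
  then have "\<P>(\<omega> in \<Omega>. \<exists>k\<le>m. Z k \<omega> = xs) \<le> \<P>(\<omega> in \<Omega>. \<not> Z m \<omega> \<in> X)"
    by (rule finite_measure_mono_AE) measurable
  also have "\<dots> = 1 - \<P>(\<omega> in \<Omega>. Z m \<omega> \<in> X)"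
    by (rule prob_neg) measurable
  finally show ?thesis
    using assms by (simp add: prob_survival)
qed

end

section \<open>Growth bound and the hitting time as a least index\<close>

lemma le_1_plus_square: "real T \<le> 1 + (real T)\<^sup>2"
  by (cases T) (simp_all add: power2_eq_square algebra_simps)

lemma accumulated_reward_eq:
  "accumulated_reward xs r Z \<omega> =
    (if \<exists>k. 0 < k \<and> Z k \<omega> = xs then \<Sum>k<(LEAST k. 0 < k \<and> Z k \<omega> = xs). r (Z k \<omega>) else 0)"
  and hitting_time_eq:
  "hitting_time xs Z \<omega> =
    (if \<exists>k. 0 < k \<and> Z k \<omega> = xs then enat (LEAST k. 0 < k \<and> Z k \<omega> = xs) else \<infinity>)"
proof -
  show *: "hitting_time xs Z \<omega> =
    (if \<exists>k. 0 < k \<and> Z k \<omega> = xs then enat (LEAST k. 0 < k \<and> Z k \<omega> = xs) else \<infinity>)"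
  proof (cases "\<exists>k. 0 < k \<and> Z k \<omega> = xs")
    case True
    then have "0 < (LEAST k. 0 < k \<and> Z k \<omega> = xs) \<and> Z (LEAST k. 0 < k \<and> Z k \<omega> = xs) \<omega> = xs"
      by (rule LeastI_ex)
    then have "Inf {enat k | k. 0 < k \<and> Z k \<omega> = xs} = enat (LEAST k. 0 < k \<and> Z k \<omega> = xs)"
      by (intro cInf_eq_minimum) (auto intro: Least_le)
    with True show ?thesis
      by (simp add: hitting_time_def)
  next
    case False
    then have "{enat k | k. 0 < k \<and> Z k \<omega> = xs} = {}" by auto
    with False show ?thesis
      by (simp only: hitting_time_def if_False) (simp add: top_enat_def)
  qed
  show "accumulated_reward xs r Z \<omega> =
    (if \<exists>k. 0 < k \<and> Z k \<omega> = xs then \<Sum>k<(LEAST k. 0 < k \<and> Z k \<omega> = xs). r (Z k \<omega>) else 0)"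
    \<comment> \<open>Without a hit every index lies below \<infinity>; the sum over this infinite
      set is 0 by convention, matching the \<open>else\<close> branch.\<close>
    unfolding accumulated_reward_def * by (simp add: lessThan_def)
qed

section \<open>Moments of the accumulated reward\<close>

locale transient_chain = absorbing_chain \<Omega> X xs P x Z + transient X P m
  for \<Omega> :: "'w measure" and X :: "'s set" and xs P x Z m
begin

text \<open>Almost every path satisfies this for some \<open>T\<close>. Working with such a path
  makes the hitting time and all rewards explicit finite expressions.\<close>

definition absorbed_at :: "nat \<Rightarrow> 'w \<Rightarrow> bool" where
  "absorbed_at T \<omega> \<longleftrightarrow> 0 < T \<and> \<omega> \<in> space \<Omega> \<and> (\<forall>k. Z k \<omega> = xs \<longleftrightarrow> T \<le> k)"

text \<open>The event of never reaching \<open>xs\<close> lies in every survival event, and their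
  probabilities tend to 0.\<close>

lemma AE_hits: "AE \<omega> in \<Omega>. \<exists>k. Z k \<omega> = xs"
proof -
  have "\<P>(\<omega> in \<Omega>. \<forall>k. Z k \<omega> \<noteq> xs) \<le> survival k x" for k
    unfolding prob_survival[symmetric] by (intro finite_measure_mono) (auto simp: Z_in_X_iff)
  then have "\<P>(\<omega> in \<Omega>. \<forall>k. Z k \<omega> \<noteq> xs) \<le> 0"
    by (intro LIMSEQ_le_const[OF survival_tendsto_0[OF x_in]]) auto
  then have "\<P>(\<omega> in \<Omega>. \<forall>k. Z k \<omega> \<noteq> xs) = 0"
    by (simp add: measure_le_0_iff)
  then have "AE \<omega> in \<Omega>. \<not> (\<forall>k. Z k \<omega> \<noteq> xs)"
    by (subst (asm) prob_Collect_eq_0) auto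
  then show ?thesis by simp
qed

lemma AE_absorbed: "AE \<omega> in \<Omega>. \<exists>T. absorbed_at T \<omega>"
  using AE_start AE_absorbing AE_hits AE_space
proof eventually_elim
  case (elim \<omega>)
  define T where "T = (LEAST k. Z k \<omega> = xs)"
  have T: "Z T \<omega> = xs"
    unfolding T_def using elim(3) by (rule LeastI_ex)
  have "Z k \<omega> = xs \<longleftrightarrow> T \<le> k" for k
    using absorbing_le[OF elim(2) T] Least_le[of "\<lambda>k. Z k \<omega> = xs" k] unfolding T_def by blast
  \<comment> \<open>The start lies in \<open>X\<close>, so the restriction to positive times in
    \<open>hitting_time\<close> does not change the first visit.\<close>
  moreover have "0 < T"
    using T elim(1) x_in xs_notin by (cases T) auto
  ultimately show ?case
    using elim(4) by (auto simp: absorbed_at_def)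
qed

lemma absorbed_at_in_X: "absorbed_at T \<omega> \<Longrightarrow> Z k \<omega> \<in> X \<longleftrightarrow> k < T"
  by (simp add: absorbed_at_def Z_in_X_iff not_le)

lemma absorbed_at_Least:
  assumes "absorbed_at T \<omega>"
  shows "\<exists>k. 0 < k \<and> Z k \<omega> = xs" and "(LEAST k. 0 < k \<and> Z k \<omega> = xs) = T"
proof -
  have "0 < T" and iff: "Z k \<omega> = xs \<longleftrightarrow> T \<le> k" for k
    using assms by (simp_all add: absorbed_at_def)
  then show "\<exists>k. 0 < k \<and> Z k \<omega> = xs" by auto
  show "(LEAST k. 0 < k \<and> Z k \<omega> = xs) = T"
    unfolding iff using \<open>0 < T\<close> by (intro Least_equality) auto
qed

lemma AE_hitting_time_finite: "AE \<omega> in \<Omega>. hitting_time xs Z \<omega> < \<infinity>"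
  using AE_absorbed by eventually_elim (auto simp: hitting_time_eq dest: absorbed_at_Least(1))

lemma accumulated_reward_absorbed:
  "absorbed_at T \<omega> \<Longrightarrow> accumulated_reward xs r Z \<omega> = (\<Sum>k<T. r (Z k \<omega>))"
  by (simp add: accumulated_reward_eq absorbed_at_Least)

lemma borel_measurable_accumulated_reward [measurable]:
  "accumulated_reward xs r Z \<in> borel_measurable \<Omega>"
proof -
  note borel_measurable_Z[of r, measurable]
  \<comment> \<open>The number of summands is random but takes countably many values, and for each
    fixed value the sum is measurable.\<close>
  have [measurable]: "(\<lambda>\<omega>. \<Sum>k<(LEAST k. 0 < k \<and> Z k \<omega> = xs). r (Z k \<omega>)) \<in> borel_measurable \<Omega>"
    by (rule measurable_compose_countable[where f = "\<lambda>T \<omega>. \<Sum>k<T. r (Z k \<omega>)"]) measurable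
  show ?thesis
    unfolding accumulated_reward_eq[abs_def] by measurable
qed

text \<open>On a path absorbed at time \<open>T\<close>, this is \<open>T\<^sup>2\<close>, the sum of the first \<open>T\<close> odd numbers.\<close>

definition square_time :: "'w \<Rightarrow> real" where
  "square_time \<omega> = (\<Sum>k. (2 * real k + 1) * indicator X (Z k \<omega>))"

lemma square_time_sums:
  assumes "absorbed_at T \<omega>"
  shows "(\<lambda>k. (2 * real k + 1) * indicator X (Z k \<omega>)) sums (real T)\<^sup>2"
proof -
  have "(\<lambda>k. (2 * real k + 1) * indicator X (Z k \<omega>)) sums
      (\<Sum>k<T. (2 * real k + 1) * indicator X (Z k \<omega>))"
    using absorbed_at_in_X[OF assms] by (intro sums_finite) auto
  also have "(\<Sum>k<T. (2 * real k + 1) * indicator X (Z k \<omega>)) = (\<Sum>k<T. 2 * real k + 1)"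
    using absorbed_at_in_X[OF assms] by (intro sum.cong) auto
  also have "\<dots> = (real T)\<^sup>2"
    by (induction T) (auto simp: power2_eq_square algebra_simps)
  finally show ?thesis .
qed

text \<open>The expected terms are the weighted survival probabilities, whose summability permits
  exchanging sum and integral.\<close>

lemma integrable_square_time: "integrable \<Omega> square_time"
  unfolding square_time_def
proof (rule integrable_suminf)
  show "integrable \<Omega> (\<lambda>\<omega>. (2 * real k + 1) * indicator X (Z k \<omega>))" for k
    by (rule integrable_const_bound[where B = "2 * real k + 1"]) (auto simp: indicator_def)
  show "AE \<omega> in \<Omega>. summable (\<lambda>k. norm ((2 * real k + 1) * indicator X (Z k \<omega>)))"
    using AE_absorbed by eventually_elim (auto simp: abs_mult dest: square_time_sums sums_summable)
  have "expectation (\<lambda>\<omega>. norm ((2 * real k + 1) * indicator X (Z k \<omega>))) =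
      (2 * real k + 1) * survival k x" for k
    by (simp add: abs_mult expectation_survival)
  then show "summable (\<lambda>k. expectation (\<lambda>\<omega>. norm ((2 * real k + 1) * indicator X (Z k \<omega>))))"
    using summable_survival[OF x_in] by simp
qed

text \<open>Dominated convergence with majorant \<open>K * (1 + square_time \<omega>)\<close>:
  almost every path makes \<open>s N\<close> eventually equal to \<open>f\<close>, so the constant
  expectation passes to the limit.\<close>

lemma expectation_limit:
  fixes f :: "'w \<Rightarrow> real"
  assumes [measurable]: "f \<in> borel_measurable \<Omega>" "\<And>N. s N \<in> borel_measurable \<Omega>"
    and bound: "\<And>N T \<omega>. absorbed_at T \<omega> \<Longrightarrow> \<bar>s N \<omega>\<bar> \<le> K * (1 + (real T)\<^sup>2)"
    and eventually_eq: "\<And>N T \<omega>. absorbed_at T \<omega> \<Longrightarrow> T \<le> N \<Longrightarrow> s N \<omega> = f \<omega>"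
    and const: "\<And>N. expectation (s N) = c"
  shows "integrable \<Omega> f" "expectation f = c"
proof -
  let ?w = "\<lambda>\<omega>. K * (1 + square_time \<omega>)"
  have w: "integrable \<Omega> ?w"
    using integrable_square_time by auto
  have lim: "AE \<omega> in \<Omega>. (\<lambda>N. s N \<omega>) \<longlonglongrightarrow> f \<omega>"
    using AE_absorbed
  proof eventually_elim
    case (elim \<omega>)
    then obtain T where T: "absorbed_at T \<omega>" by blast
    show ?case
      using eventually_eq[OF T] by (intro tendsto_eventually eventually_sequentiallyI[of T])
  qed
  have dom: "AE \<omega> in \<Omega>. norm (s N \<omega>) \<le> ?w \<omega>" for N
    using AE_absorbed
  proof eventually_elim
    case (elim \<omega>)
    then obtain T where T: "absorbed_at T \<omega>" by blast
    show ?case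
      using bound[OF T, of N] sums_unique[OF square_time_sums[OF T]] by (simp add: square_time_def)
  qed
  show "integrable \<Omega> f"
    by (rule integrable_dominated_convergence[OF _ _ w lim dom]) measurable
  have "(\<lambda>N. expectation (s N)) \<longlonglongrightarrow> expectation f"
    by (rule integral_dominated_convergence[OF _ _ w lim dom]) measurable
  then show "expectation f = c"
    by (simp add: const LIMSEQ_const_iff)
qed

text \<open>With zero values off \<open>X\<close> the equations extend to \<open>xs\<close>, and the
  processes below stop changing after absorption. \<open>accumulated_reward_moments\<close> reduces
  the general case to this one.\<close>

context
  fixes r J M :: "'s \<Rightarrow> real"
  assumes outside: "\<And>y. y \<notin> X \<Longrightarrow> r y = 0" "\<And>y. y \<notin> X \<Longrightarrow> J y = 0" "\<And>y. y \<notin> X \<Longrightarrow> M y = 0"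
    and equations: "moment_equations X P r J M"
begin

section \<open>Processes with constant expectation\<close>

definition partial_reward :: "nat \<Rightarrow> 'w \<Rightarrow> real" where
  "partial_reward N \<omega> = (\<Sum>k<N. r (Z k \<omega>))"

lemma borel_measurable_partial_reward [measurable]:
  "partial_reward N \<in> borel_measurable \<Omega>"
  unfolding partial_reward_def[abs_def] by (intro borel_measurable_sum borel_measurable_Z)

lemma partial_reward_absorbed:
  assumes "absorbed_at T \<omega>" "T \<le> N"
  shows "partial_reward N \<omega> = accumulated_reward xs r Z \<omega>"
proof -
  have "(\<Sum>k<N. r (Z k \<omega>)) = (\<Sum>k<T. r (Z k \<omega>))"
    using assms absorbed_at_in_X[OF assms(1)] outside by (intro sum.mono_neutral_right) auto
  then show ?thesis
    by (simp add: partial_reward_def accumulated_reward_absorbed[OF assms(1)])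
qed

lemma abs_partial_reward_le:
  assumes "absorbed_at T \<omega>" and C: "\<And>y. \<bar>r y\<bar> \<le> C"
  shows "\<bar>partial_reward N \<omega>\<bar> \<le> C * T"
proof -
  have C0: "0 \<le> C" using C[of x] by linarith
  have "\<bar>partial_reward N \<omega>\<bar> \<le> (\<Sum>k<N. \<bar>r (Z k \<omega>)\<bar>)"
    by (simp add: partial_reward_def)
  \<comment> \<open>Rewards vanish from time \<open>T\<close> on, so at most \<open>T\<close>
    summands remain.\<close>
  also have "\<dots> = (\<Sum>k\<in>{..<N} \<inter> {..<T}. \<bar>r (Z k \<omega>)\<bar>)"
    using absorbed_at_in_X[OF assms(1)] outside by (intro sum.mono_neutral_right) auto
  also have "\<dots> \<le> of_nat (card ({..<N} \<inter> {..<T})) * C"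
    using C by (intro sum_bounded_above) auto
  also have "\<dots> \<le> C * T"
    using C0 card_mono[of "{..<T}" "{..<N} \<inter> {..<T}"] by (auto simp: mult.commute intro!: mult_left_mono)
  finally show ?thesis .
qed

lemma bounded_outside:
  assumes "\<And>y. y \<notin> X \<Longrightarrow> g y = (0::real)"
  obtains C where "\<And>y. \<bar>g y\<bar> \<le> C"
proof -
  obtain C where C: "\<And>y. y \<in> X \<Longrightarrow> \<bar>g y\<bar> \<le> C"
    by (rule bounded_on_X) (rule that)
  have "\<bar>g y\<bar> \<le> max C 0" for y
    using C[of y] assms[of y] by (cases "y \<in> X") auto
  then show ?thesis by (rule that)
qed

lemma Q_sum_J: "z \<in> S \<Longrightarrow> (\<Sum>y\<in>S. Q z y * J y) = J z - r z"
  using equations outside xs_notin by (subst Q_sum_step) (auto simp: moment_equations_def step_def)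

text \<open>The mixed term uses the first equation: on \<open>X\<close> the sum of
  \<open>P z y * J y\<close> is \<open>J z - r z\<close>. At \<open>xs\<close> all terms are
  0.\<close>

lemma Q_sum_M: "z \<in> S \<Longrightarrow> (\<Sum>y\<in>S. Q z y * M y) = M z - (r z)\<^sup>2 - 2 * r z * (J z - r z)"
  using equations outside xs_notin by (subst Q_sum_step) (auto simp: moment_equations_def step_def)

lemma partial_reward_Suc: "partial_reward (Suc N) \<omega> = partial_reward N \<omega> + r (Z N \<omega>)"
  by (simp add: partial_reward_def)

text \<open>Reward already collected plus expected reward to go: one transition moves
  \<open>r (Z N)\<close> from the second summand to the first.\<close>

lemma expectation_first: "expectation (\<lambda>\<omega>. partial_reward N \<omega> + J (Z N \<omega>)) = J x"
proof (induction N)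
  case 0
  then show ?case by (simp add: partial_reward_def expectation_start)
next
  case (Suc N)
  \<comment> \<open>\<open>partial_reward (Suc N)\<close> involves only the states up to time
    \<open>N\<close>, so it belongs to the history and only \<open>J\<close> is averaged over the
    new state.\<close>
  have "expectation (\<lambda>\<omega>. partial_reward (Suc N) \<omega> + J (Z (Suc N) \<omega>)) =
      expectation (\<lambda>\<omega>. \<Sum>y\<in>S. Q (Z N \<omega>) y * (partial_reward (Suc N) \<omega> + J y))"
    unfolding partial_reward_def
    by (rule expectation_step[of N "\<lambda>h y. (\<Sum>k<Suc N. r (h k)) + J y"]) auto
  also have "\<dots> = expectation (\<lambda>\<omega>. partial_reward N \<omega> + J (Z N \<omega>))"
  proof (rule Bochner_Integration.integral_cong[OF refl])
    fix \<omega> assume \<omega>: "\<omega> \<in> space \<Omega>"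
    let ?A = "partial_reward (Suc N) \<omega>" and ?q = "Q (Z N \<omega>)"
    have "(\<Sum>y\<in>S. ?q y * (?A + J y)) = ?A * (\<Sum>y\<in>S. ?q y) + (\<Sum>y\<in>S. ?q y * J y)"
      unfolding sum_distrib_left sum.distrib[symmetric]
      by (rule sum.cong) (simp_all add: algebra_simps)
    also have "\<dots> = partial_reward N \<omega> + J (Z N \<omega>)"
      unfolding Q_sum[OF Z_in[OF \<omega>]] Q_sum_J[OF Z_in[OF \<omega>]] partial_reward_Suc by simp
    finally show "(\<Sum>y\<in>S. ?q y * (?A + J y)) = partial_reward N \<omega> + J (Z N \<omega>)" .
  qed
  finally show ?case using Suc by simp
qed

text \<open>Expanding the square of collected reward plus reward to go, and averaging the latter,
  produces this expression; the two equations make its mean invariant under one transition.\<close>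

lemma expectation_second:
  "expectation (\<lambda>\<omega>. (partial_reward N \<omega>)\<^sup>2 + 2 * partial_reward N \<omega> * J (Z N \<omega>) + M (Z N \<omega>)) = M x"
proof (induction N)
  case 0
  then show ?case by (simp add: partial_reward_def expectation_start)
next
  case (Suc N)
  have "expectation (\<lambda>\<omega>. (partial_reward (Suc N) \<omega>)\<^sup>2 +
        2 * partial_reward (Suc N) \<omega> * J (Z (Suc N) \<omega>) + M (Z (Suc N) \<omega>)) =
      expectation (\<lambda>\<omega>. \<Sum>y\<in>S. Q (Z N \<omega>) y * ((partial_reward (Suc N) \<omega>)\<^sup>2 +
        2 * partial_reward (Suc N) \<omega> * J y + M y))"
    unfolding partial_reward_def
    by (rule expectation_step[of N
          "\<lambda>h y. (\<Sum>k<Suc N. r (h k))\<^sup>2 + 2 * (\<Sum>k<Suc N. r (h k)) * J y + M y"]) auto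
  also have "\<dots> = expectation (\<lambda>\<omega>. (partial_reward N \<omega>)\<^sup>2 +
      2 * partial_reward N \<omega> * J (Z N \<omega>) + M (Z N \<omega>))"
  proof (rule Bochner_Integration.integral_cong[OF refl])
    fix \<omega> assume \<omega>: "\<omega> \<in> space \<Omega>"
    let ?A = "partial_reward (Suc N) \<omega>" and ?q = "Q (Z N \<omega>)"
    have "(\<Sum>y\<in>S. ?q y * (?A\<^sup>2 + 2 * ?A * J y + M y)) =
        ?A\<^sup>2 * (\<Sum>y\<in>S. ?q y) + 2 * ?A * (\<Sum>y\<in>S. ?q y * J y) + (\<Sum>y\<in>S. ?q y * M y)"
      unfolding sum_distrib_left sum.distrib[symmetric]
      by (rule sum.cong) (simp_all add: algebra_simps)
    also have "\<dots> = (partial_reward N \<omega>)\<^sup>2 + 2 * partial_reward N \<omega> * J (Z N \<omega>) + M (Z N \<omega>)"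
      unfolding Q_sum[OF Z_in[OF \<omega>]] Q_sum_J[OF Z_in[OF \<omega>]] Q_sum_M[OF Z_in[OF \<omega>]]
        partial_reward_Suc
      by (simp add: power2_eq_square algebra_simps)
    finally show "(\<Sum>y\<in>S. ?q y * (?A\<^sup>2 + 2 * ?A * J y + M y)) =
        (partial_reward N \<omega>)\<^sup>2 + 2 * partial_reward N \<omega> * J (Z N \<omega>) + M (Z N \<omega>)" .
  qed
  finally show ?case using Suc by simp
qed

section \<open>Passage to the limit and identification of the moments\<close>

lemma absorbed_at_outside:
  assumes "absorbed_at T \<omega>" "T \<le> N"
  shows "J (Z N \<omega>) = 0" "M (Z N \<omega>) = 0"
  using absorbed_at_in_X[OF assms(1), of N] assms(2) outside by auto

lemma accumulated_reward_first:
  shows "integrable \<Omega> (accumulated_reward xs r Z)"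
    and "expectation (accumulated_reward xs r Z) = J x"
proof -
  obtain C where C: "\<And>y. \<bar>r y\<bar> \<le> C"
    by (rule bounded_outside[of r, OF outside(1)]) (assumption, rule that)
  obtain D where D: "\<And>y. \<bar>J y\<bar> \<le> D"
    by (rule bounded_outside[of J, OF outside(2)]) (assumption, rule that)
  have "0 \<le> C" "0 \<le> D" using C[of x] D[of x] by linarith+
  \<comment> \<open>The natural bound is linear in \<open>T\<close>; it is enlarged to the quadratic
    form required by \<open>expectation_limit\<close>.\<close>
  have bound: "\<bar>partial_reward N \<omega> + J (Z N \<omega>)\<bar> \<le> (C + D) * (1 + (real T)\<^sup>2)"
    if T: "absorbed_at T \<omega>" for N T \<omega>
  proof -
    have "\<bar>partial_reward N \<omega> + J (Z N \<omega>)\<bar> \<le> C * T + D"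
      using abs_partial_reward_le[OF T C, of N] D[of "Z N \<omega>"] by linarith
    also have "\<dots> \<le> C * (1 + (real T)\<^sup>2) + D * (1 + (real T)\<^sup>2)"
    proof (intro add_mono mult_left_mono)
      show "real T \<le> 1 + (real T)\<^sup>2" by (rule le_1_plus_square)
      show "D \<le> D * (1 + (real T)\<^sup>2)"
        using \<open>0 \<le> D\<close> by (simp add: algebra_simps)
    qed fact
    finally show ?thesis by (simp add: algebra_simps)
  qed
  show "integrable \<Omega> (accumulated_reward xs r Z)"
    by (rule expectation_limit(1)[where s = "\<lambda>N \<omega>. partial_reward N \<omega> + J (Z N \<omega>)",
          OF _ _ bound _ expectation_first])
      (auto simp: partial_reward_absorbed absorbed_at_outside
        intro!: borel_measurable_add borel_measurable_times borel_measurable_Z)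
  show "expectation (accumulated_reward xs r Z) = J x"
    by (rule expectation_limit(2)[where s = "\<lambda>N \<omega>. partial_reward N \<omega> + J (Z N \<omega>)",
          OF _ _ bound _ expectation_first])
      (auto simp: partial_reward_absorbed absorbed_at_outside
        intro!: borel_measurable_add borel_measurable_times borel_measurable_Z)
qed

lemma accumulated_reward_second:
  shows "integrable \<Omega> (\<lambda>\<omega>. (accumulated_reward xs r Z \<omega>)\<^sup>2)"
    and "expectation (\<lambda>\<omega>. (accumulated_reward xs r Z \<omega>)\<^sup>2) = M x"
proof -
  obtain C where C: "\<And>y. \<bar>r y\<bar> \<le> C"
    by (rule bounded_outside[of r, OF outside(1)]) (assumption, rule that)
  obtain D where D: "\<And>y. \<bar>J y\<bar> \<le> D"
    by (rule bounded_outside[of J, OF outside(2)]) (assumption, rule that)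
  obtain F where F: "\<And>y. \<bar>M y\<bar> \<le> F"
    by (rule bounded_outside[of M, OF outside(3)]) (assumption, rule that)
  have nonneg: "0 \<le> C" "0 \<le> D" "0 \<le> F" using C[of x] D[of x] F[of x] by linarith+
  \<comment> \<open>The three constants bound the three summands: \<open>C * T\<close> squared,
    twice \<open>C * T\<close> times \<open>D\<close>, and \<open>F\<close>.\<close>
  have bound: "\<bar>(partial_reward N \<omega>)\<^sup>2 + 2 * partial_reward N \<omega> * J (Z N \<omega>) + M (Z N \<omega>)\<bar>
      \<le> (C\<^sup>2 + 2 * C * D + F) * (1 + (real T)\<^sup>2)"
    if T: "absorbed_at T \<omega>" for N T \<omega>
  proof -
    have A: "\<bar>partial_reward N \<omega>\<bar> \<le> C * T"
      by (rule abs_partial_reward_le[OF T C])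
    have "(partial_reward N \<omega>)\<^sup>2 \<le> (C * T)\<^sup>2"
      using A by (metis abs_ge_zero power2_abs power_mono)
    then have "(partial_reward N \<omega>)\<^sup>2 \<le> C\<^sup>2 * (real T)\<^sup>2"
      by (simp add: power_mult_distrib)
    then have 1: "\<bar>(partial_reward N \<omega>)\<^sup>2\<bar> \<le> C\<^sup>2 * (1 + (real T)\<^sup>2)"
      by (simp add: distrib_left add_increasing)
    have "\<bar>partial_reward N \<omega>\<bar> * \<bar>J (Z N \<omega>)\<bar> \<le> (C * T) * D"
      using A D nonneg by (intro mult_mono) auto
    also have "\<dots> = (C * D) * T"
      by simp
    also have "\<dots> \<le> (C * D) * (1 + (real T)\<^sup>2)"
      using nonneg by (intro mult_left_mono le_1_plus_square) simp
    finally have 2: "\<bar>2 * partial_reward N \<omega> * J (Z N \<omega>)\<bar> \<le> (2 * C * D) * (1 + (real T)\<^sup>2)"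
      by (simp add: abs_mult)
    have 3: "\<bar>M (Z N \<omega>)\<bar> \<le> F * (1 + (real T)\<^sup>2)"
    proof -
      have "\<bar>M (Z N \<omega>)\<bar> \<le> F * 1"
        using F[of "Z N \<omega>"] by simp
      also have "\<dots> \<le> F * (1 + (real T)\<^sup>2)"
        using nonneg by (intro mult_left_mono) auto
      finally show ?thesis .
    qed
    show ?thesis
      using 1 2 3 unfolding distrib_right by linarith
  qed
  show "integrable \<Omega> (\<lambda>\<omega>. (accumulated_reward xs r Z \<omega>)\<^sup>2)"
    by (rule expectation_limit(1)[where s = "\<lambda>N \<omega>. (partial_reward N \<omega>)\<^sup>2 +
            2 * partial_reward N \<omega> * J (Z N \<omega>) + M (Z N \<omega>)",
          OF _ _ bound _ expectation_second])
      (auto simp: partial_reward_absorbed absorbed_at_outside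
        intro!: borel_measurable_add borel_measurable_times borel_measurable_Z)
  show "expectation (\<lambda>\<omega>. (accumulated_reward xs r Z \<omega>)\<^sup>2) = M x"
    by (rule expectation_limit(2)[where s = "\<lambda>N \<omega>. (partial_reward N \<omega>)\<^sup>2 +
            2 * partial_reward N \<omega> * J (Z N \<omega>) + M (Z N \<omega>)",
          OF _ _ bound _ expectation_second])
      (auto simp: partial_reward_absorbed absorbed_at_outside
        intro!: borel_measurable_add borel_measurable_times borel_measurable_Z)
qed

end

lemma accumulated_reward_moments:
  assumes "moment_equations X P r J M"
  shows "integrable \<Omega> (accumulated_reward xs r Z)"
    and "expectation (accumulated_reward xs r Z) = J x"
    and "integrable \<Omega> (\<lambda>\<omega>. (accumulated_reward xs r Z \<omega>)\<^sup>2)"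
    and "expectation (\<lambda>\<omega>. (accumulated_reward xs r Z \<omega>)\<^sup>2) = M x"
proof -
  let ?z = "\<lambda>f y. if y \<in> X then f y else (0::real)"
  have eqs: "moment_equations X P (?z r) (?z J) (?z M)"
    using assms by (simp add: moment_equations_def)
  \<comment> \<open>Extending \<open>r\<close> by zero changes nothing on absorbed paths, which stay
    in \<open>X\<close> until time \<open>T\<close>.\<close>
  have AE_eq: "AE \<omega> in \<Omega>. accumulated_reward xs (?z r) Z \<omega> = accumulated_reward xs r Z \<omega>"
    using AE_absorbed
    by eventually_elim (auto simp: accumulated_reward_absorbed absorbed_at_in_X intro!: sum.cong)
  then have AE_eq2: "AE \<omega> in \<Omega>. (accumulated_reward xs (?z r) Z \<omega>)\<^sup>2 = (accumulated_reward xs r Z \<omega>)\<^sup>2"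
    by eventually_elim simp
  note first = accumulated_reward_first[of "?z r" "?z J" "?z M", OF _ _ _ eqs]
  note second = accumulated_reward_second[of "?z r" "?z J" "?z M", OF _ _ _ eqs]
  show "integrable \<Omega> (accumulated_reward xs r Z)"
    using first(1) by (subst integrable_cong_AE[OF _ _ AE_eq, symmetric]) auto
  show "expectation (accumulated_reward xs r Z) = J x"
    using first(2) x_in by (subst integral_cong_AE[OF _ _ AE_eq, symmetric]) auto
  show "integrable \<Omega> (\<lambda>\<omega>. (accumulated_reward xs r Z \<omega>)\<^sup>2)"
    using second(1) by (subst integrable_cong_AE[OF _ _ AE_eq2, symmetric]) auto
  show "expectation (\<lambda>\<omega>. (accumulated_reward xs r Z \<omega>)\<^sup>2) = M x"
    using second(2) x_in by (subst integral_cong_AE[OF _ _ AE_eq2, symmetric]) auto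
qed

end

theorem proposition2:
  fixes n :: nat and X :: "nat set" and xs :: nat
    and P :: "nat \<Rightarrow> nat \<Rightarrow> real" and r :: "nat \<Rightarrow> real"
    and \<Omega> :: "nat \<Rightarrow> 'w measure" and Z :: "nat \<Rightarrow> 'w \<Rightarrow> nat"
  assumes "X = {1..n}" and "xs \<notin> X"
    and "transition_probabilities X xs P"
    and "\<And>x. x \<in> X \<Longrightarrow> markov_chain_from (insert xs X) (absorbing_extension xs P) x (\<Omega> x) Z"
    and "proper X xs \<Omega> Z"
  shows "(\<forall>x\<in>X. (AE \<omega> in \<Omega> x. hitting_time xs Z \<omega> < \<infinity>) \<and>
            integrable (\<Omega> x) (accumulated_reward xs r Z) \<and>
            integrable (\<Omega> x) (\<lambda>\<omega>. (accumulated_reward xs r Z \<omega>)\<^sup>2)) \<and>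
         moment_equations X P r (value_function xs r \<Omega> Z) (second_moment xs r \<Omega> Z) \<and>
         (\<exists>!(J, M). J \<in> X \<rightarrow>\<^sub>E UNIV \<and> M \<in> X \<rightarrow>\<^sub>E UNIV \<and> moment_equations X P r J M)"
proof (cases "X = {}")
  \<comment> \<open>For empty \<open>X\<close> the equations are vacuous, and the only extensional
    functions are constantly \<open>undefined\<close>.\<close>
  case True
  then have "(\<lambda>(J, M). J \<in> X \<rightarrow>\<^sub>E UNIV \<and> M \<in> X \<rightarrow>\<^sub>E UNIV \<and> moment_equations X P r J M) =
      (\<lambda>p. p = (\<lambda>x. undefined, \<lambda>x. undefined))"
    by (auto simp: fun_eq_iff moment_equations_def)
  with True show ?thesis
    by (simp add: moment_equations_def)
next
  case False
  have chain: "absorbing_chain (\<Omega> x) X xs P x Z" if "x \<in> X" for x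
  proof -
    have "prob_space (\<Omega> x)"
      using assms(4)[OF that] by (simp add: markov_chain_from_def)
    then show ?thesis
      using assms that by (simp add: absorbing_chain_def absorbing_chain_axioms_def)
  qed
  obtain x0 where "x0 \<in> X" using False by blast
  have "substochastic X P"
  proof -
    \<comment> \<open>Any initial state serves, since the conclusion concerns \<open>X\<close> and
      \<open>P\<close> alone.\<close>
    interpret absorbing_chain "\<Omega> x0" X xs P x0 Z
      by (rule chain) fact
    show ?thesis by (rule substochastic_axioms)
  qed
  then interpret substochastic X P .
  \<comment> \<open>\<open>card X\<close> is the time horizon in the definition of
    \<open>proper\<close>.\<close>
  interpret transient X P "card X"
  proof
    show "0 < card X"
      using False finite_X by (simp add: card_gt_0_iff)
    show "survival (card X) x < 1" if "x \<in> X" for x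
      using assms(5) that
      by (intro absorbing_chain.survival_less_1_if_reaches[OF chain[OF that]]) (simp add: proper_def)
  qed
  have transient_chain: "transient_chain (\<Omega> x) X xs P x Z (card X)" if "x \<in> X" for x
    using chain[OF that] transient_axioms by (simp add: transient_chain_def)
  obtain J M where JM: "moment_equations X P r J M"
    using moment_equations_exists by blast
  \<comment> \<open>One solution \<open>(J, M)\<close> serves all initial states: the chain from
    \<open>x\<close> has moments \<open>J x\<close> and \<open>M x\<close>, so the equations
    transfer to the moment functions.\<close>
  note moments = transient_chain.accumulated_reward_moments[OF transient_chain JM]
  have "moment_equations X P r (value_function xs r \<Omega> Z) (second_moment xs r \<Omega> Z) \<longleftrightarrow>
      moment_equations X P r J M"
    by (rule moment_equations_cong)
      (simp_all only: value_function_def second_moment_def moments(2,4))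
  with JM have "moment_equations X P r (value_function xs r \<Omega> Z) (second_moment xs r \<Omega> Z)"
    by simp
  then show ?thesis
    using transient_chain.AE_hitting_time_finite[OF transient_chain] moments(1,3)
    by (intro conjI ballI ex1_moment_equations) simp_all
qed

end
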